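(* Let $\kappa,\lambda,\mu$ be cardinals such that $\mathfrak{c}\leq\kappa=\kappa^\omega<\lambda$ and $2^\kappa=2^\lambda=\mu$. Then there is a $\kappa^+$-irresolvable, connected, locally connected, pseudocompact space $X$ such that $|X|=\Delta(X)=\lambda$ and $X$ is homeomorphic to a dense subset of $[0,1]^\mu$.
   Context: $\mathfrak{c}=2^{\omega}$, and $\kappa^+$ is the successor cardinal of $\kappa$. The cube $[0,1]^\mu$ carries the Tychonoff product topology. The dispersion character $\Delta(X)$ of a space $X$ is the smallest cardinality of a nonempty open subset of $X$. For a cardinal $\nu$, a space $X$ is $\nu$-resolvable if it contains $\nu$ many pairwise disjoint dense subsets; $X$ is $\nu$-irresolvable if $\nu\leq\Delta(X)$ and $X$ is not $\nu$-resolvable. A space is locally connected if it has a base consisting of connected sets ("globally connected" in the paper means connected). A space is pseudocompact if every continuous real-valued function on it is bounded. *)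

theory Defs
  imports "HOL-Analysis.Analysis"
begin

unbundle cardinal_syntax

text \<open>
  Cardinals are cardinal orders \<open>r\<close> with \<open>Card_order r\<close>, on an arbitrary type and
  compared with \<open>=o\<close>, \<open>\<le>o\<close>, \<open><o\<close>; thus \<open>natLeq\<close> is $\omega$, \<open>ctwo ^c r\<close> is $2^r$ and
  \<open>cardSuc r\<close> is $r^+$.
\<close>

abbreviation continuum :: "(nat \<Rightarrow> bool) rel" where
  "continuum \<equiv> ctwo ^c natLeq"

definition dense_subset :: "'a topology \<Rightarrow> 'a set \<Rightarrow> bool" where
  "dense_subset X D \<longleftrightarrow> D \<subseteq> topspace X \<and> X closure_of D = topspace X"

text \<open>
  The choice below is between equal cardinals only; the value is unspecified for the
  empty space, which has no nonempty open subset.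
\<close>

definition dispersion_character :: "'a topology \<Rightarrow> 'a rel" where
  "dispersion_character X =
     (SOME r. (\<exists>U. openin X U \<and> U \<noteq> {} \<and> r = |U| ) \<and>
              (\<forall>V. openin X V \<and> V \<noteq> {} \<longrightarrow> r \<le>o |V| ))"

lemma dispersion_character_attained:
  assumes "topspace X \<noteq> {}"
  shows "(\<exists>U. openin X U \<and> U \<noteq> {} \<and> dispersion_character X = |U| ) \<and>
         (\<forall>V. openin X V \<and> V \<noteq> {} \<longrightarrow> dispersion_character X \<le>o |V| )"
proof -
  let ?R = "card_of ` {U. openin X U \<and> U \<noteq> {}}"
  have "?R \<noteq> {}"
    using assms openin_topspace by blast
  moreover have "\<forall>r\<in>?R. Card_order r"
    by (auto simp: card_of_Card_order)
  ultimately obtain r where "r \<in> ?R" "\<forall>r'\<in>?R. r \<le>o r'"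
    using exists_minim_Card_order[of ?R] by blast
  then have "(\<exists>U. openin X U \<and> U \<noteq> {} \<and> r = |U| ) \<and>
             (\<forall>V. openin X V \<and> V \<noteq> {} \<longrightarrow> r \<le>o |V| )"
    by auto
  then show ?thesis
    unfolding dispersion_character_def by (rule someI)
qed

definition resolvable_space :: "'c rel \<Rightarrow> 'a topology \<Rightarrow> bool" where
  "resolvable_space \<nu> X \<longleftrightarrow>
     (\<exists>\<D> :: 'a set set. |\<D>| =o \<nu> \<and> pairwise disjnt \<D> \<and> (\<forall>D\<in>\<D>. dense_subset X D))"

definition irresolvable_space :: "'c rel \<Rightarrow> 'a topology \<Rightarrow> bool" where
  "irresolvable_space \<nu> X \<longleftrightarrow>
     \<nu> \<le>o dispersion_character X \<and> \<not> resolvable_space \<nu> X"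

definition pseudocompact_space :: "'a topology \<Rightarrow> bool" where
  "pseudocompact_space X \<longleftrightarrow>
     (\<forall>f. continuous_map X euclideanreal f \<longrightarrow> bounded (f ` topspace X))"

definition unit_cube :: "'m rel \<Rightarrow> ('m \<Rightarrow> real) topology" where
  "unit_cube \<mu> = product_topology (\<lambda>_. top_of_set {0..1}) (Field \<mu>)"

text \<open>
  The library's \<^const>\<open>locally_connected_space\<close> asks for arbitrarily small connected
  neighbourhoods; this is the same as having a base of connected open sets.
\<close>

lemma locally_connected_space_iff_base:
  "locally_connected_space X \<longleftrightarrow>
     (\<exists>\<B>. (\<forall>B\<in>\<B>. openin X B \<and> connectedin X B) \<and>
          (\<forall>W. openin X W \<longrightarrow> (\<exists>\<U>. \<U> \<subseteq> \<B> \<and> \<Union>\<U> = W)))"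
  (is "?L \<longleftrightarrow> ?R")
proof
  assume L: ?L
  let ?B = "{B. openin X B \<and> connectedin X B}"
  have "\<exists>\<U>. \<U> \<subseteq> ?B \<and> \<Union>\<U> = W" if W: "openin X W" for W
  proof (intro exI conjI)
    show "{B \<in> ?B. B \<subseteq> W} \<subseteq> ?B" by blast
    show "\<Union>{B \<in> ?B. B \<subseteq> W} = W"
      using L W unfolding locally_connected_space by blast
  qed
  then show ?R by (intro exI[of _ ?B]) blast
next
  assume ?R
  then obtain \<B> where B: "\<forall>B\<in>\<B>. openin X B \<and> connectedin X B"
      "\<forall>W. openin X W \<longrightarrow> (\<exists>\<U>. \<U> \<subseteq> \<B> \<and> \<Union>\<U> = W)"
    by blast
  show ?L
    unfolding locally_connected_space
  proof (intro allI impI)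
    fix W x assume "openin X W \<and> x \<in> W"
    then obtain \<U> where "\<U> \<subseteq> \<B>" "\<Union>\<U> = W" "x \<in> W" using B(2) by blast
    then show "\<exists>U. openin X U \<and> connectedin X U \<and> x \<in> U \<and> U \<subseteq> W"
      using B(1) by blast
  qed
qed

end

theory Submission
  imports Defs
begin

text \<open>
  The space is the union of two subsets of the cube, one small and one large, with opposite
  tasks.

  The small part \<open>P\<close> has size at most \<open>\<kappa>\<close> and matches every point of the cube in any countably many
  prescribed coordinates (\<open>ex_small_G_delta_dense\<close>, which uses $\kappa^\omega=\kappa$ and
  $\mu\leq 2^\kappa$). It is moreover closed under line segments (\<open>segment_closure\<close>). The first
  property passes to larger subsets of the cube and implies density and pseudocompactness
  (\<open>G_delta_dense_imp_pseudocompact\<close>). By the second, \<open>P\<close> meets each box with interval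
  sides in a connected set, and this set is dense in what any larger subspace has in that box.
  Hence every subspace that contains \<open>P\<close> is connected and locally connected
  (\<open>dense_segment_closed_connected\<close>). So any points of the cube may be added to \<open>P\<close>.

  The large part \<open>Z\<close> has at most \<open>\<Lambda>\<close> points, has \<open>\<Lambda>\<close> of them in every box, and contains no two
  disjoint dense sets (\<open>ex_irresolvable_large_subset\<close>). It arises from \<open>\<Lambda>\<close> many copies of \<open>P\<close>
  by resetting coordinates to 0 on the members of a maximal ideal of sets with large complements
  (\<open>maximal_ideal_with_large_complements\<close>): the ideal consists of subsets of a set of size \<open>\<Lambda>\<close>,
  so $2^\lambda\leq\mu$ provides enough coordinates to turn all of its members into nowhere dense sets.

  In the union, a disjoint family of more than \<open>\<kappa>\<close> sets has two members that miss \<open>P\<close>, as \<open>P\<close> has at most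
  \<open>\<kappa>\<close> points (\<open>two_members_avoid_small_set\<close>). If both were dense, they would be disjoint dense
  subsets of \<open>Z\<close>. So the union is not \<open>\<kappa>\<^sup>+\<close>-resolvable, while all its nonempty open sets have
  size \<open>\<Lambda>\<close>.
\<close>

section \<open>Subsets of the cube that match points on countable sets of coordinates\<close>

abbreviation Cube :: "'m set \<Rightarrow> ('m \<Rightarrow> real) topology" where
  "Cube M \<equiv> product_topology (\<lambda>_. top_of_set {0..1}) M"

text \<open>
  The standard basic open sets of the cube, with nonempty sides so that a box is never empty.
\<close>

definition cube_box :: "'m set \<Rightarrow> ('m \<Rightarrow> real set) \<Rightarrow> bool" where
  "cube_box M W \<longleftrightarrow> finite {\<alpha>\<in>M. W \<alpha> \<noteq> {0..1}} \<and>
     (\<forall>\<alpha>\<in>M. openin (top_of_set {0..1}) (W \<alpha>) \<and> W \<alpha> \<noteq> {})"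

text \<open>
  Every point of the cube can be matched in countably many prescribed coordinates;
  equivalently, \<open>E\<close> meets every nonempty $G_\delta$ subset of the cube.
\<close>

definition G_delta_dense :: "'m set \<Rightarrow> ('m \<Rightarrow> real) set \<Rightarrow> bool" where
  "G_delta_dense M E \<longleftrightarrow> E \<subseteq> (\<Pi>\<^sub>E \<alpha>\<in>M. {0..1}) \<and>
     (\<forall>A y. countable A \<longrightarrow> A \<subseteq> M \<longrightarrow> y \<in> (\<Pi>\<^sub>E \<alpha>\<in>M. {0..1}) \<longrightarrow> (\<exists>x\<in>E. \<forall>\<alpha>\<in>A. x \<alpha> = y \<alpha>))"

definition segment_closed :: "'m set \<Rightarrow> ('m \<Rightarrow> real) set \<Rightarrow> bool" where
  "segment_closed M P \<longleftrightarrow>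
     (\<forall>u\<in>P. \<forall>v\<in>P. \<forall>t\<in>{0..1}. (\<lambda>\<alpha>\<in>M. (1 - t) * u \<alpha> + t * v \<alpha>) \<in> P)"

lemma box_subset_cube:
  assumes "cube_box M W" shows "PiE M W \<subseteq> (\<Pi>\<^sub>E \<alpha>\<in>M. {0..1})"
  using assms unfolding cube_box_def by (intro PiE_mono) (blast dest: openin_imp_subset)

lemma openin_box:
  assumes "cube_box M W" shows "openin (Cube M) (PiE M W)"
  using assms unfolding cube_box_def openin_PiE_gen by simp

lemma box_nonempty:
  assumes "cube_box M W" shows "PiE M W \<noteq> {}"
  using assms unfolding cube_box_def PiE_eq_empty_iff by simp

text \<open>
  Sides that are intervals are what makes a box convex, and convexity is the only source of
  connectedness below.
\<close>

lemma convex_box_neighbourhood: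
  assumes "openin (Cube M) S" "x \<in> S"
  obtains W where "cube_box M W" "\<And>\<alpha>. \<alpha> \<in> M \<Longrightarrow> convex (W \<alpha>)" "x \<in> PiE M W" "PiE M W \<subseteq> S"
proof -
  obtain U where fin: "finite {\<alpha>\<in>M. U \<alpha> \<noteq> {0..1}}"
    and op: "\<forall>\<alpha>\<in>M. openin (top_of_set {0..1}) (U \<alpha>)"
    and x: "x \<in> PiE M U" and sub: "PiE M U \<subseteq> S"
    using assms unfolding openin_product_topology_alt by (auto 0 3)
  have "\<exists>V. openin (top_of_set {0..1}) V \<and> convex V \<and> x \<alpha> \<in> V \<and> V \<subseteq> U \<alpha> \<and>
          (U \<alpha> = {0..1} \<longrightarrow> V = {0..1})" if "\<alpha> \<in> M" for \<alpha>
  proof (cases "U \<alpha> = {0..1}")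
    case True
    then show ?thesis using x that by (intro exI[of _ "{0..1}"]) auto
  next
    case False
    have xa: "x \<alpha> \<in> U \<alpha>" using x that by auto
    have opa: "openin (top_of_set {0..1}) (U \<alpha>)" using op that by blast
    then obtain e where e: "e > 0" "ball (x \<alpha>) e \<inter> {0..1} \<subseteq> U \<alpha>"
      using xa unfolding openin_contains_ball by meson
    have "x \<alpha> \<in> {0..1}" using openin_imp_subset[OF opa] xa by (rule subsetD)
    moreover have "openin (top_of_set {0..1}) ({0..1} \<inter> ball (x \<alpha>) e)"
      by (intro openin_open_Int open_ball)
    moreover have "convex ({0..1} \<inter> ball (x \<alpha>) e)"
      by (intro convex_Int convex_ball convex_real_interval)
    ultimately show ?thesis using False e
      by (intro exI[of _ "{0..1} \<inter> ball (x \<alpha>) e"]) (simp add: Int_commute)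
  qed
  then obtain W where W: "\<And>\<alpha>. \<alpha> \<in> M \<Longrightarrow> openin (top_of_set {0..1}) (W \<alpha>) \<and> convex (W \<alpha>) \<and>
      x \<alpha> \<in> W \<alpha> \<and> W \<alpha> \<subseteq> U \<alpha> \<and> (U \<alpha> = {0..1} \<longrightarrow> W \<alpha> = {0..1})"
    by metis
  have "{\<alpha>\<in>M. W \<alpha> \<noteq> {0..1}} \<subseteq> {\<alpha>\<in>M. U \<alpha> \<noteq> {0..1}}" using W by blast
  then have "cube_box M W" unfolding cube_box_def using W finite_subset[OF _ fin] by blast
  moreover have "x \<in> PiE M W" using W x by (auto simp: PiE_iff)
  moreover have "PiE M W \<subseteq> S"
    using W by (intro subset_trans[OF PiE_mono sub]) simp
  ultimately show thesis using that W by blast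
qed

lemma G_delta_dense_meets_box:
  assumes "G_delta_dense M E" "cube_box M W" "y \<in> PiE M W"
  obtains x where "x \<in> E" "x \<in> PiE M W" "\<And>\<alpha>. \<alpha> \<in> M \<Longrightarrow> W \<alpha> \<noteq> {0..1} \<Longrightarrow> x \<alpha> = y \<alpha>"
proof -
  let ?A = "{\<alpha>\<in>M. W \<alpha> \<noteq> {0..1}}"
  have "countable ?A" using assms(2) unfolding cube_box_def by (simp add: countable_finite)
  moreover have "y \<in> (\<Pi>\<^sub>E \<alpha>\<in>M. {0..1})" using assms box_subset_cube by blast
  ultimately obtain x where x: "x \<in> E" "\<forall>\<alpha>\<in>?A. x \<alpha> = y \<alpha>"
    using assms(1) unfolding G_delta_dense_def by blast
  have "x \<in> (\<Pi>\<^sub>E \<alpha>\<in>M. {0..1})" using x assms(1) unfolding G_delta_dense_def by blast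
  moreover have "x \<alpha> \<in> W \<alpha>" if "\<alpha> \<in> M" for \<alpha>
    using that x(2) assms(3) calculation by (cases "W \<alpha> = {0..1}") (auto simp: PiE_iff)
  ultimately have "x \<in> PiE M W" by (auto simp: PiE_iff)
  then show thesis using that x by blast
qed

lemma G_delta_dense_imp_dense:
  assumes "G_delta_dense M E"
  shows "E \<subseteq> topspace (Cube M)" "Cube M closure_of E = topspace (Cube M)"
proof -
  show "E \<subseteq> topspace (Cube M)" using assms unfolding G_delta_dense_def by simp
  have "\<exists>y\<in>E. y \<in> T" if "openin (Cube M) T" "x \<in> T" for x T
    using convex_box_neighbourhood[OF that] G_delta_dense_meets_box[OF assms] by (metis subset_iff)
  then show "Cube M closure_of E = topspace (Cube M)"
    unfolding closure_of_def by blast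
qed

lemma G_delta_dense_mono:
  assumes "G_delta_dense M P" "P \<subseteq> E" "E \<subseteq> (\<Pi>\<^sub>E \<alpha>\<in>M. {0..1})"
  shows "G_delta_dense M E"
  using assms unfolding G_delta_dense_def by (metis subsetD)

text \<open>
  If \<open>f\<close> were unbounded, there would be boxes \<open>B n\<close> on whose trace \<open>\<bar>f\<bar> > n\<close>. Compactness
  of the cube gives a cluster point \<open>y\<close> of these boxes. Together they constrain only
  countably many coordinates, so some \<open>x \<in> E\<close> agrees with \<open>y\<close> on all of these and is a cluster
  point of the boxes as well; then \<open>f\<close> is unbounded near \<open>x\<close>.
\<close>

lemma G_delta_dense_imp_pseudocompact:
  assumes E: "G_delta_dense M E"
  shows "pseudocompact_space (subtopology (Cube M) E)"
  unfolding pseudocompact_space_def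
proof (intro allI impI)
  fix f assume f: "continuous_map (subtopology (Cube M) E) euclideanreal f"
  have Esub: "E \<subseteq> (\<Pi>\<^sub>E \<alpha>\<in>M. {0..1})" using E unfolding G_delta_dense_def by blast
  then have tE: "topspace (subtopology (Cube M) E) = E" by auto
  have pre: "\<exists>W. cube_box M W \<and> x \<in> PiE M W \<and> (\<forall>y\<in>PiE M W \<inter> E. f y \<in> O')"
    if "open O'" "x \<in> E" "f x \<in> O'" for O' x
  proof -
    have "openin (subtopology (Cube M) E) {y\<in>E. f y \<in> O'}"
      using openin_continuous_map_preimage[OF f, of O'] that(1) unfolding tE by (simp flip: open_openin)
    then obtain S where S: "openin (Cube M) S" "{y\<in>E. f y \<in> O'} = S \<inter> E"
      unfolding openin_subtopology by blast
    have "x \<in> S" using S(2) that(2,3) by blast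
    from convex_box_neighbourhood[OF S(1) this]
    obtain W where W: "cube_box M W" "x \<in> PiE M W" "PiE M W \<subseteq> S" .
    have "f y \<in> O'" if "y \<in> PiE M W \<inter> E" for y
      using that W(3) S(2) by blast
    then show ?thesis using W by blast
  qed
  show "bounded (f ` topspace (subtopology (Cube M) E))"
  proof (rule ccontr)
    assume "\<not> bounded (f ` topspace (subtopology (Cube M) E))"
    then have unb: "\<exists>x\<in>E. \<bar>f x\<bar> > real n" for n
      unfolding tE bounded_iff by (auto simp: not_le)
    have open_gt: "open {r::real. \<bar>r\<bar> > c}" and open_lt: "open {r::real. \<bar>r\<bar> < c}" for c
      by (intro open_Collect_less continuous_intros)+
    have "\<exists>W. cube_box M W \<and> (\<forall>y\<in>PiE M W \<inter> E. \<bar>f y\<bar> > real n)" for n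
    proof -
      obtain x where x: "x \<in> E" "\<bar>f x\<bar> > real n" using unb by blast
      show ?thesis using pre[OF open_gt x(1)] x(2) unfolding mem_Collect_eq by meson
    qed
    then obtain B where B': "\<And>n. cube_box M (B n) \<and> (\<forall>y\<in>PiE M (B n) \<inter> E. \<bar>f y\<bar> > real n)"
      by metis
    then have B: "\<And>n. cube_box M (B n)" "\<And>n y. y \<in> PiE M (B n) \<Longrightarrow> y \<in> E \<Longrightarrow> \<bar>f y\<bar> > real n"
      by blast+
    define C where "C n = Cube M closure_of (\<Union>m\<in>{n..}. PiE M (B m))" for n
    have "compact_space (Cube M)"
      by (simp add: compact_space_product_topology compact_space_subtopology)
    moreover have "C n \<noteq> {}" for n
    proof -
      have "PiE M (B n) \<subseteq> C n" unfolding C_def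
        using box_subset_cube[OF B(1)] by (intro subset_trans[OF _ closure_of_subset]) auto
      then show ?thesis using box_nonempty[OF B(1)[of n]] by blast
    qed
    moreover have "decseq C" unfolding C_def decseq_def
      by (intro allI impI closure_of_mono UN_mono) auto
    moreover have "closedin (Cube M) (C n)" for n unfolding C_def by simp
    ultimately have "(\<Inter>n. C n) \<noteq> {}"
      using compact_space_imp_nest[of "Cube M" C] by blast
    then obtain y where y: "\<And>n. y \<in> C n" by blast
    have yc: "y \<in> (\<Pi>\<^sub>E \<alpha>\<in>M. {0..1})" using y[of 0] closure_of_subset_topspace unfolding C_def by fastforce
    define A where "A = (\<Union>n. {\<alpha>\<in>M. B n \<alpha> \<noteq> {0..1}})"
    have "countable A" unfolding A_def using B(1) unfolding cube_box_def by (auto intro: countable_finite)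
    moreover have "A \<subseteq> M" unfolding A_def by blast
    ultimately obtain x where x: "x \<in> E" "\<forall>\<alpha>\<in>A. x \<alpha> = y \<alpha>"
      using E yc unfolding G_delta_dense_def by blast
    obtain k where k: "\<bar>f x\<bar> < real k" using reals_Archimedean2 by blast
    obtain N where N: "cube_box M N" "x \<in> PiE M N" "\<And>z. z \<in> PiE M N \<Longrightarrow> z \<in> E \<Longrightarrow> \<bar>f z\<bar> < real k"
      using pre[OF open_lt[of "real k"] x(1)] k unfolding mem_Collect_eq by (meson IntI)
    \<comment> \<open>Only the constraints of \<open>N\<close> that lie in \<open>A\<close> can be transferred from \<open>x\<close> to \<open>y\<close>.\<close>
    define N' where "N' \<alpha> = (if \<alpha> \<in> A then N \<alpha> else {0..1})" for \<alpha>
    have "{\<alpha>\<in>M. N' \<alpha> \<noteq> {0..1}} \<subseteq> {\<alpha>\<in>M. N \<alpha> \<noteq> {0..1}}" unfolding N'_def by auto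
    then have "finite {\<alpha>\<in>M. N' \<alpha> \<noteq> {0..1}}"
      using N(1) unfolding cube_box_def by (metis finite_subset)
    then have "cube_box M N'" using N(1) unfolding cube_box_def by (simp add: N'_def)
    moreover have "y \<in> PiE M N'" using yc N(2) x(2) \<open>A \<subseteq> M\<close> unfolding N'_def PiE_iff
      by (auto split: if_splits)
    ultimately obtain z m where z: "z \<in> PiE M N'" "z \<in> PiE M (B m)" "m \<ge> k"
      using y[of k] openin_box[of M N'] unfolding C_def in_closure_of by blast
    \<comment> \<open>Off \<open>A\<close> the box \<open>B m\<close> is unconstrained, so there the coordinates of \<open>x\<close> may be used.\<close>
    define w where "w = (\<lambda>\<alpha>\<in>M. if \<alpha> \<in> A then z \<alpha> else x \<alpha>)"
    have xc: "x \<in> (\<Pi>\<^sub>E \<alpha>\<in>M. {0..1})" using x Esub by blast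
    have "w \<in> PiE M N" using z(1) N(2) unfolding w_def N'_def PiE_iff by (auto split: if_splits)
    moreover have "w \<in> PiE M (B m)"
      using z(2) xc unfolding w_def PiE_iff by (auto simp: A_def)
    ultimately have "w \<in> PiE M N \<inter> PiE M (B m)" by blast
    moreover have "openin (Cube M) (PiE M N \<inter> PiE M (B m))"
      using openin_box N(1) B(1) by (intro openin_Int) auto
    ultimately have "E \<inter> (PiE M N \<inter> PiE M (B m)) \<noteq> {}"
      using iffD1[OF dense_intersects_open G_delta_dense_imp_dense(2)[OF E]] by (metis empty_iff)
    then obtain v where "v \<in> E" "v \<in> PiE M N" "v \<in> PiE M (B m)" by blast
    then show False using N(3)[of v] B(2)[of v m] z(3) by force
  qed
qed

text \<open>
  The segment between two points of a box with convex sides stays in the box, and it is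
  continuous in the product topology because it is so in each coordinate.
\<close>

lemma segment_closed_meets_box_connected:
  assumes P: "segment_closed M P" "P \<subseteq> (\<Pi>\<^sub>E \<alpha>\<in>M. {0..1})"
    and W: "cube_box M W" "\<And>\<alpha>. \<alpha> \<in> M \<Longrightarrow> convex (W \<alpha>)"
  shows "connectedin (Cube M) (PiE M W \<inter> P)"
proof (rule path_connectedin_imp_connectedin, unfold path_connectedin, intro conjI ballI)
  show "PiE M W \<inter> P \<subseteq> topspace (Cube M)" using P by auto
  fix u v assume uv: "u \<in> PiE M W \<inter> P" "v \<in> PiE M W \<inter> P"
  let ?g = "\<lambda>t. \<lambda>\<alpha>\<in>M. (1 - t) * u \<alpha> + t * v \<alpha>"
  have W': "(1 - t) * u \<alpha> + t * v \<alpha> \<in> W \<alpha>" if "t \<in> {0..1}" "\<alpha> \<in> M" for t \<alpha>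
    using convexD[OF W(2)[OF that(2)], of "u \<alpha>" "v \<alpha>" "1 - t" t] that uv by (auto simp: PiE_iff)
  have WW: "?g t \<in> PiE M W" if "t \<in> {0..1}" for t using W' that by auto
  have im: "?g ` {0..1} \<subseteq> PiE M W \<inter> P"
    using P(1) WW uv unfolding segment_closed_def by (intro image_subsetI IntI) auto
  have "continuous_map (top_of_set {0..1}) (top_of_set {0..1}) (\<lambda>t. ?g t \<alpha>)" if "\<alpha> \<in> M" for \<alpha>
  proof -
    have "W \<alpha> \<subseteq> {0..1}" using W(1) that unfolding cube_box_def by (blast dest: openin_imp_subset)
    then have "(\<lambda>t. ?g t \<alpha>) \<in> {0..1} \<rightarrow> {0..1}" using W'[OF _ that] that by auto
    moreover have "continuous_on {0..1} (\<lambda>t. ?g t \<alpha>)"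
      using that by (simp, intro continuous_intros)
    ultimately show ?thesis
      unfolding continuous_map_in_subtopology continuous_map_iff_continuous topspace_euclidean_subtopology
      by blast
  qed
  then have "pathin (Cube M) ?g"
    unfolding pathin_def continuous_map_componentwise by auto
  moreover have "?g 0 = u" "?g 1 = v"
    using uv by (auto simp: PiE_iff extensional_def restrict_def)
  ultimately show "\<exists>g. pathin (Cube M) g \<and> g \<in> {0..1} \<rightarrow> PiE M W \<inter> P \<and> g 0 = u \<and> g 1 = v"
    using im by (intro exI[of _ ?g]) auto
qed

text \<open>
  In an open box, \<open>E\<close> lies between the connected set that \<open>P\<close> cuts out there and the closure
  of that set, whatever the points of \<open>E - P\<close> are.
\<close>

lemma dense_segment_closed_connected:
  assumes P: "segment_closed M P" "G_delta_dense M P"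
    and E: "P \<subseteq> E" "E \<subseteq> (\<Pi>\<^sub>E \<alpha>\<in>M. {0..1})"
    and W: "cube_box M W" "\<And>\<alpha>. \<alpha> \<in> M \<Longrightarrow> convex (W \<alpha>)"
  shows "connectedin (subtopology (Cube M) E) (PiE M W \<inter> E)"
proof -
  have "PiE M W \<inter> E \<subseteq> PiE M W \<inter> Cube M closure_of P"
    using E G_delta_dense_imp_dense(2)[OF P(2)] by auto
  also have "\<dots> \<subseteq> Cube M closure_of (PiE M W \<inter> P)"
    by (intro openin_Int_closure_of_subset openin_box W)
  finally have "connectedin (Cube M) (PiE M W \<inter> E)"
    using E by (intro connectedin_intermediate_closure_of[OF
        segment_closed_meets_box_connected[OF P(1) _ W]]) auto
  then show ?thesis unfolding connectedin_subtopology by blast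
qed

lemma dense_segment_closed_imp_connected:
  assumes "segment_closed M P" "G_delta_dense M P" "P \<subseteq> E" "E \<subseteq> (\<Pi>\<^sub>E \<alpha>\<in>M. {0..1})"
  shows "connected_space (subtopology (Cube M) E)"
proof -
  have "connectedin (subtopology (Cube M) E) ((\<Pi>\<^sub>E \<alpha>\<in>M. {0..1}) \<inter> E)"
    by (rule dense_segment_closed_connected[OF assms]) (auto simp: cube_box_def)
  moreover have "(\<Pi>\<^sub>E \<alpha>\<in>M. {0..1}) \<inter> E = topspace (subtopology (Cube M) E)" by simp
  ultimately show ?thesis by (metis connectedin_topspace)
qed

lemma dense_segment_closed_imp_locally_connected:
  assumes "segment_closed M P" "G_delta_dense M P" "P \<subseteq> E" "E \<subseteq> (\<Pi>\<^sub>E \<alpha>\<in>M. {0..1})"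
  shows "locally_connected_space (subtopology (Cube M) E)"
  unfolding locally_connected_space
proof (intro allI impI)
  fix S x assume S: "openin (subtopology (Cube M) E) S \<and> x \<in> S"
  then obtain T where T: "openin (Cube M) T" "S = T \<inter> E" unfolding openin_subtopology by blast
  then have "x \<in> T" using S by blast
  from convex_box_neighbourhood[OF T(1) this]
  obtain W where W: "cube_box M W" "\<And>\<alpha>. \<alpha> \<in> M \<Longrightarrow> convex (W \<alpha>)" "x \<in> PiE M W" "PiE M W \<subseteq> T"
    by metis
  show "\<exists>U. openin (subtopology (Cube M) E) U \<and> connectedin (subtopology (Cube M) E) U \<and> x \<in> U \<and> U \<subseteq> S"
  proof (intro exI conjI)
    show "openin (subtopology (Cube M) E) (PiE M W \<inter> E)"
      unfolding openin_subtopology using openin_box[OF W(1)] by blast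
    show "connectedin (subtopology (Cube M) E) (PiE M W \<inter> E)"
      using dense_segment_closed_connected[OF assms W(1)] W(2) by blast
  qed (use W S T in blast)+
qed

section \<open>A small convex set matching points on countable sets of coordinates\<close>

lemma continuum_eq: "continuum = |UNIV :: (nat \<Rightarrow> bool) set|"
  by (simp add: cexp_def ctwo_def Field_natLeq Func_def Field_card_of)

lemma continuum_reals: "|UNIV :: real set| \<le>o continuum"
proof -
  obtain q :: "nat \<Rightarrow> real" where q: "range q = \<rat>"
    using countable_rat by (metis Rats_0 empty_iff uncountable_def)
  define g where "g x n \<longleftrightarrow> q n < x" for x :: real and n
  have "inj g"
  proof (rule linorder_injI)
    fix x y :: real assume "x < y"
    then obtain r where "r \<in> \<rat>" "x < r" "r < y" using Rats_dense_in_real by blast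
    then obtain n where "x < q n" "q n < y" using q by (metis imageE)
    then have "g x n \<noteq> g y n" unfolding g_def by simp
    then show "g x \<noteq> g y" by metis
  qed
  then have "|UNIV :: real set| \<le>o |UNIV :: (nat \<Rightarrow> bool) set|"
    by (intro card_of_ordLeqI) auto
  then show ?thesis unfolding continuum_eq .
qed

text \<open>
  Countably many pairs have to be told apart, and one argument suffices for each pair.
\<close>

lemma countable_separating_sequence:
  assumes "countable A" "inj_on c A" "c ` A \<subseteq> Func K (UNIV :: 'b set)" "K \<noteq> {}"
  obtains s :: "nat \<Rightarrow> 'k" where "range s \<subseteq> K"
    "\<And>\<alpha> \<beta>. \<alpha> \<in> A \<Longrightarrow> \<beta> \<in> A \<Longrightarrow> (\<lambda>j. c \<alpha> (s j)) = (\<lambda>j. c \<beta> (s j)) \<Longrightarrow> \<alpha> = \<beta>"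
proof -
  have "\<exists>k\<in>K. \<alpha> \<noteq> \<beta> \<longrightarrow> c \<alpha> k \<noteq> c \<beta> k" if "\<alpha> \<in> A" "\<beta> \<in> A" for \<alpha> \<beta>
  proof (cases "\<alpha> = \<beta>")
    case False
    then have "c \<alpha> \<noteq> c \<beta>" using assms(2) that by (auto dest: inj_onD)
    then obtain k where "c \<alpha> k \<noteq> c \<beta> k" by blast
    moreover have "c \<alpha> \<in> Func K UNIV" "c \<beta> \<in> Func K UNIV" using assms(3) that by auto
    ultimately have "k \<in> K" unfolding Func_def by (metis (mono_tags, lifting) mem_Collect_eq)
    then show ?thesis using \<open>c \<alpha> k \<noteq> c \<beta> k\<close> by blast
  qed (use assms(4) in blast)
  then obtain d where d: "\<And>\<alpha> \<beta>. \<alpha> \<in> A \<Longrightarrow> \<beta> \<in> A \<Longrightarrow> d \<alpha> \<beta> \<in> K \<and> (\<alpha> \<noteq> \<beta> \<longrightarrow> c \<alpha> (d \<alpha> \<beta>) \<noteq> c \<beta> (d \<alpha> \<beta>))"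
    by metis
  obtain k0 where k0: "k0 \<in> K" using assms(4) by blast
  let ?D = "insert k0 ((\<lambda>(\<alpha>, \<beta>). d \<alpha> \<beta>) ` (A \<times> A))"
  have "countable ?D" using assms(1) by simp
  then have r: "range (from_nat_into ?D) = ?D" by (simp add: range_from_nat_into)
  show thesis
  proof (rule that[of "from_nat_into ?D"])
    show "range (from_nat_into ?D) \<subseteq> K" unfolding r using d k0 by auto
    fix \<alpha> \<beta> assume ab: "\<alpha> \<in> A" "\<beta> \<in> A"
      "(\<lambda>j. c \<alpha> (from_nat_into ?D j)) = (\<lambda>j. c \<beta> (from_nat_into ?D j))"
    have "d \<alpha> \<beta> \<in> range (from_nat_into ?D)" unfolding r using ab by auto
    then obtain j where "from_nat_into ?D j = d \<alpha> \<beta>" by (metis imageE)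
    then show "\<alpha> = \<beta>" using d[OF ab(1,2)] fun_cong[OF ab(3), of j] by metis
  qed
qed

text \<open>
  The Hewitt--Marczewski--Pondiczery theorem for countable supports. Coordinates are coded as
  subsets \<open>c \<alpha>\<close> of \<open>\<kappa>\<close>. A point is coded by a countable sequence in \<open>\<kappa>\<close>, and there are only
  \<open>\<kappa>\<close> of these; it lists a countable set of test arguments, countably many
  0-1 patterns, and countably many values. The coordinate \<open>\<alpha>\<close> of the point is the value listed with
  the first pattern that \<open>c \<alpha>\<close> shows on the test arguments. For a countable set of coordinates,
  test arguments that separate them allow any values to be prescribed.
\<close>

lemma ex_small_G_delta_dense:
  fixes \<kappa> :: "'k rel" and M :: "'m set"
  assumes \<kappa>: "Card_order \<kappa>" "continuum \<le>o \<kappa>" "\<kappa> =o \<kappa> ^c natLeq"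
    and M: "|M| \<le>o ctwo ^c \<kappa>"
  obtains P where "G_delta_dense M P" "|P| \<le>o \<kappa>"
proof -
  let ?K = "Field \<kappa>"
  have K\<kappa>: "|?K| =o \<kappa>" using card_of_Field_ordIso \<kappa>(1) .
  have le_K: "|S| \<le>o |?K|" if "|S| \<le>o continuum" for S :: "'s set"
    using that \<kappa>(2) ordIso_symmetric[OF K\<kappa>] by (meson ordLeq_transitive ordLeq_ordIso_trans)
  have "|UNIV :: (nat \<Rightarrow> bool) set| \<le>o |?K|"
    by (rule le_K) (unfold continuum_eq, rule card_of_mono1, simp)
  then obtain \<sigma> :: "'k \<Rightarrow> nat \<Rightarrow> bool" where \<sigma>: "\<sigma> ` ?K = UNIV"
    by (metis card_of_ordLeq2 UNIV_not_empty)
  then have "?K \<noteq> {}" by auto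
  have "|{0..1::real}| \<le>o |?K|"
    by (rule le_K) (meson card_of_mono1 subset_UNIV ordLeq_transitive continuum_reals)
  then obtain \<rho> :: "'k \<Rightarrow> real" where \<rho>: "\<rho> ` ?K = {0..1}"
    using card_of_ordLeq2[of "{0..1::real}" ?K] by auto
  have "|M| \<le>o |Func ?K (UNIV :: bool set)|" using M by (simp add: cexp_def ctwo_def Field_card_of)
  then obtain c where c: "inj_on c M" "c ` M \<subseteq> Func ?K (UNIV :: bool set)"
    unfolding card_of_ordLeq[symmetric] by auto
  \<comment> \<open>The three lists are interleaved in \<open>u\<close>: test arguments, patterns and values sit at the
    positions congruent to 0, 1 and 2 modulo 3.\<close>
  define fits where "fits u \<alpha> n \<longleftrightarrow> \<sigma> (u (3 * n + 1)) = (\<lambda>j. c \<alpha> (u (3 * j)))" for u \<alpha> n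
  define val where "val u = (\<lambda>\<alpha>\<in>M. if \<exists>n. fits u \<alpha> n then \<rho> (u (3 * (LEAST n. fits u \<alpha> n) + 2)) else 0)"
    for u
  let ?U = "Func (UNIV :: nat set) ?K"
  have "|val ` ?U| \<le>o |?U|" by (rule card_of_image)
  also have "|?U| = \<kappa> ^c natLeq" by (simp add: cexp_def Field_natLeq)
  also have "\<kappa> ^c natLeq =o \<kappa>" using \<kappa>(3) by (rule ordIso_symmetric)
  finally have card: "|val ` ?U| \<le>o \<kappa>" .
  have "G_delta_dense M (val ` ?U)" unfolding G_delta_dense_def
  proof (intro conjI allI impI)
    have "\<rho> (u n) \<in> {0..1}" if "u \<in> ?U" for u n using that \<rho> unfolding Func_def by blast
    then show "val ` ?U \<subseteq> (\<Pi>\<^sub>E \<alpha>\<in>M. {0..1})"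
      unfolding val_def by (intro image_subsetI) (simp add: restrict_PiE_iff)
    fix A y assume A: "countable A" "A \<subseteq> M" and y: "y \<in> (\<Pi>\<^sub>E \<alpha>\<in>M. {0..1::real})"
    have cA: "inj_on c A" "c ` A \<subseteq> Func ?K UNIV"
      using inj_on_subset[OF c(1) A(2)] subset_trans[OF image_mono[OF A(2)] c(2)] by blast+
    obtain s :: "nat \<Rightarrow> 'k" where s: "range s \<subseteq> ?K"
      "\<And>\<alpha> \<beta>. \<alpha> \<in> A \<Longrightarrow> \<beta> \<in> A \<Longrightarrow> (\<lambda>j. c \<alpha> (s j)) = (\<lambda>j. c \<beta> (s j)) \<Longrightarrow> \<alpha> = \<beta>"
      using countable_separating_sequence[OF A(1) cA \<open>?K \<noteq> {}\<close>] by metis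
    let ?a = "from_nat_into A"
    have "\<exists>k\<in>?K. \<sigma> k = (\<lambda>j. c (?a n) (s j))" for n using \<sigma> by (metis UNIV_I imageE)
    then obtain t where t: "\<And>n. t n \<in> ?K" "\<And>n. \<sigma> (t n) = (\<lambda>j. c (?a n) (s j))" by metis
    have "\<exists>k\<in>?K. ?a n \<in> A \<longrightarrow> \<rho> k = y (?a n)" for n
    proof (cases "?a n \<in> A")
      case True
      then have "y (?a n) \<in> \<rho> ` ?K" using y A(2) unfolding \<rho> by (auto simp: PiE_iff)
      then show ?thesis by force
    qed (use \<open>?K \<noteq> {}\<close> in blast)
    then obtain r where r: "\<And>n. r n \<in> ?K" "\<And>n. ?a n \<in> A \<Longrightarrow> \<rho> (r n) = y (?a n)" by metis
    define u where "u i = (if i mod 3 = 0 then s (i div 3) else if i mod 3 = 1 then t (i div 3)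
      else r (i div 3))" for i
    have u: "u (3 * n) = s n" "u (3 * n + 1) = t n" "u (3 * n + 2) = r n" for n
    proof -
      have "(3 * n + 1) mod 3 = 1" "(3 * n + 2) mod 3 = 2" "(3 * n + 1) div 3 = n" "(3 * n + 2) div 3 = n"
        by presburger+
      then show "u (3 * n) = s n" "u (3 * n + 1) = t n" "u (3 * n + 2) = r n"
        unfolding u_def by simp_all
    qed
    have "u \<in> ?U" using s(1) t(1) r(1) unfolding Func_def u_def by auto
    moreover have "val u \<alpha> = y \<alpha>" if \<alpha>: "\<alpha> \<in> A" for \<alpha>
    proof -
      have ran: "range ?a = A" using A(1) \<alpha> by (intro range_from_nat_into) auto
      have fits: "fits u \<alpha> n \<longleftrightarrow> ?a n = \<alpha>" for n
      proof
        assume "fits u \<alpha> n"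
        then have "(\<lambda>j. c (?a n) (s j)) = (\<lambda>j. c \<alpha> (s j))" unfolding fits_def u t(2) .
        then show "?a n = \<alpha>" using s(2) \<alpha> ran by blast
      next
        assume "?a n = \<alpha>"
        then show "fits u \<alpha> n" unfolding fits_def u t(2) by simp
      qed
      obtain n where "?a n = \<alpha>" using ran \<alpha> by (metis imageE)
      then have "?a (LEAST n. ?a n = \<alpha>) = \<alpha>" by (rule LeastI)
      then have "\<rho> (r (LEAST n. ?a n = \<alpha>)) = y \<alpha>" using r(2) \<alpha> by metis
      moreover have "fits u \<alpha> = (\<lambda>n. ?a n = \<alpha>)" using fits by blast
      ultimately show ?thesis unfolding val_def u using \<alpha> A(2) \<open>?a n = \<alpha>\<close> by auto
    qed
    ultimately show "\<exists>x\<in>val ` ?U. \<forall>\<alpha>\<in>A. x \<alpha> = y \<alpha>" by blast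
  qed
  then show thesis using card by (rule that)
qed

text \<open>
  Adding all segments between points already present does not raise a cardinality of at least
  the continuum, and countably many rounds reach a fixed point.
\<close>

lemma segment_closure:
  fixes \<kappa> :: "'k rel" and M :: "'m set"
  assumes \<kappa>: "Card_order \<kappa>" "continuum \<le>o \<kappa>" and inf: "infinite (Field \<kappa>)"
    and P0: "P0 \<subseteq> (\<Pi>\<^sub>E \<alpha>\<in>M. {0..1})" "|P0| \<le>o \<kappa>"
  obtains P where "P0 \<subseteq> P" "P \<subseteq> (\<Pi>\<^sub>E \<alpha>\<in>M. {0..1})" "segment_closed M P" "|P| \<le>o \<kappa>"
proof -
  define mid where "mid = (\<lambda>(u, v, t). \<lambda>\<alpha>\<in>M. (1 - t) * u \<alpha> + t * v \<alpha> :: real)"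
  define step where "step P = P \<union> mid ` (P \<times> P \<times> {0..1})" for P
  define P where "P = (\<Union>n. (step ^^ n) P0)"
  have "|{0..1::real}| \<le>o \<kappa>"
    using continuum_reals \<kappa>(2) by (meson card_of_mono1 subset_UNIV ordLeq_transitive)
  then have "|step S| \<le>o \<kappa>" if "|S| \<le>o \<kappa>" for S
    unfolding step_def using that \<kappa>(1) inf
    by (intro card_of_Un_ordLeq_infinite_Field ordLeq_transitive[OF card_of_image]
        card_of_Times_ordLeq_infinite_Field)
  then have card: "|(step ^^ n) P0| \<le>o \<kappa>" for n by (induction n) (auto simp: P0)
  have "|P| \<le>o \<kappa>" unfolding P_def
  proof (rule card_of_UNION_ordLeq_infinite_Field[OF inf \<kappa>(1)])
    have "natLeq \<le>o \<kappa>" using inf \<kappa>(1) by (intro natLeq_ordLeq_cinfinite) (simp add: cinfinite_def)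
    then show "|UNIV :: nat set| \<le>o \<kappa>" using card_of_nat ordIso_ordLeq_trans by blast
  qed (use card in blast)
  moreover have "P \<subseteq> (\<Pi>\<^sub>E \<alpha>\<in>M. {0..1})"
  proof -
    have cv: "(1 - t) * a + t * b \<in> {0..1}" if "a \<in> {0..1}" "b \<in> {0..1}" "t \<in> {0..1}" for a b t :: real
      using convexD[OF convex_real_interval(5)[of 0 1], of a b "1 - t" t] that by auto
    have "step S \<subseteq> (\<Pi>\<^sub>E \<alpha>\<in>M. {0..1})" if "S \<subseteq> (\<Pi>\<^sub>E \<alpha>\<in>M. {0..1})" for S
      unfolding step_def mid_def
    proof (intro Un_least image_subsetI that, clarify)
      fix u v t assume "u \<in> S" "v \<in> S" "t \<in> {0..1::real}"
      then have "(1 - t) * u \<alpha> + t * v \<alpha> \<in> {0..1}" if "\<alpha> \<in> M" for \<alpha>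
        using PiE_mem[OF subsetD[OF \<open>S \<subseteq> _\<close>]] that by (intro cv) blast+
      then show "(\<lambda>\<alpha>\<in>M. (1 - t) * u \<alpha> + t * v \<alpha>) \<in> (\<Pi>\<^sub>E \<alpha>\<in>M. {0..1})" by simp
    qed
    then have "(step ^^ n) P0 \<subseteq> (\<Pi>\<^sub>E \<alpha>\<in>M. {0..1})" for n by (induction n) (auto simp: P0)
    then show ?thesis unfolding P_def by blast
  qed
  moreover have "P0 \<subseteq> P" unfolding P_def using UN_upper[of 0 UNIV "\<lambda>n. (step ^^ n) P0"] by simp
  moreover have "segment_closed M P" unfolding segment_closed_def
  proof (intro ballI)
    fix u v t assume uv: "u \<in> P" "v \<in> P" "t \<in> {0..1::real}"
    then obtain i j where ij: "u \<in> (step ^^ i) P0" "v \<in> (step ^^ j) P0" unfolding P_def by blast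
    have "mono (\<lambda>n. (step ^^ n) P0)"
      unfolding mono_iff_le_Suc by (auto simp: step_def)
    then have "u \<in> (step ^^ max i j) P0" "v \<in> (step ^^ max i j) P0"
      using ij by (meson monoD max.cobounded1 max.cobounded2 subsetD)+
    then have "mid (u, v, t) \<in> (step ^^ Suc (max i j)) P0"
      using uv(3) by (simp add: step_def)
    then have "mid (u, v, t) \<in> P" unfolding P_def by (rule UN_I[OF UNIV_I])
    then show "(\<lambda>\<alpha>\<in>M. (1 - t) * u \<alpha> + t * v \<alpha>) \<in> P" by (simp add: mid_def)
  qed
  ultimately show thesis by (intro that[of P]) assumption+
qed

section \<open>A large irresolvable set from a maximal ideal\<close>

text \<open>
  Zorn's lemma, applied to families whose finite unions leave \<open>\<Lambda>\<close> many points in each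
  \<open>U \<in> \<U>\<close>. If \<open>S\<close> cannot be added to a maximal such ideal, then \<open>S\<close> and some member of the ideal
  together cover all but fewer than \<open>\<Lambda>\<close> points of some \<open>U\<close>. The remainder belongs
  to the ideal too, since a maximal ideal absorbs every set of size less than \<open>\<Lambda>\<close>.
  So a set outside the ideal contains some \<open>U\<close> modulo the ideal.
\<close>

lemma maximal_ideal_with_large_complements:
  fixes \<Lambda> :: "'l rel" and Q :: "'q set"
  assumes \<Lambda>: "Card_order \<Lambda>" "infinite (Field \<Lambda>)"
    and \<U>: "\<And>U. U \<in> \<U> \<Longrightarrow> \<Lambda> \<le>o |U|"
  obtains \<I> where "\<I> \<subseteq> Pow Q"
    "\<And>F. finite F \<Longrightarrow> F \<subseteq> \<I> \<Longrightarrow> \<Union>F \<in> \<I>"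
    "\<And>T. T \<subseteq> Q \<Longrightarrow> |T| <o \<Lambda> \<Longrightarrow> T \<in> \<I>"
    "\<And>I U. I \<in> \<I> \<Longrightarrow> U \<in> \<U> \<Longrightarrow> \<Lambda> \<le>o |U - I|"
    "\<And>S. S \<subseteq> Q \<Longrightarrow> S \<notin> \<I> \<Longrightarrow> \<exists>U\<in>\<U>. \<exists>I\<in>\<I>. U \<inter> Q - I \<subseteq> S"
proof -
  define admissible where "admissible \<F> \<longleftrightarrow> \<F> \<subseteq> Pow Q \<and>
    (\<forall>F U. finite F \<longrightarrow> F \<subseteq> \<F> \<longrightarrow> U \<in> \<U> \<longrightarrow> \<Lambda> \<le>o |U - \<Union>F| )" for \<F>
  have admissibleD: "\<Lambda> \<le>o |U - \<Union>F|" if "admissible \<F>" "finite F" "F \<subseteq> \<F>" "U \<in> \<U>" for \<F> F U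
    using that unfolding admissible_def by simp
  have "\<exists>\<I>\<in>Collect admissible. \<forall>X\<in>Collect admissible. \<I> \<subseteq> X \<longrightarrow> X = \<I>"
  proof (rule subset_Zorn_nonempty)
    show "Collect admissible \<noteq> {}" using \<U> unfolding admissible_def by (auto intro!: exI[of _ "{}"])
    fix C assume C: "C \<noteq> {}" "subset.chain (Collect admissible) C"
    have admissibleC: "admissible \<F>" if "\<F> \<in> C" for \<F> using C that by (auto simp: subset.chain_def)
    have "\<Lambda> \<le>o |U - \<Union>F|" if F: "finite F" "F \<subseteq> \<Union>C" "U \<in> \<U>" for F U
    proof -
      obtain \<F> where "\<F> \<in> C" "F \<subseteq> \<F>" using finite_subset_Union_chain[OF F(1,2) C] by blast
      then show ?thesis using admissibleD[OF admissibleC F(1)] F(3) by blast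
    qed
    moreover have "\<Union>C \<subseteq> Pow Q" using admissibleC unfolding admissible_def by (intro Union_least) simp
    ultimately show "\<Union>C \<in> Collect admissible" unfolding admissible_def mem_Collect_eq by simp
  qed
  then obtain \<I> where admissible: "admissible \<I>" and max: "\<And>X. admissible X \<Longrightarrow> \<I> \<subseteq> X \<Longrightarrow> X = \<I>" by blast
  have unions: "\<Union>F \<in> \<I>" if F: "finite F" "F \<subseteq> \<I>" for F
  proof -
    have "admissible (insert (\<Union>F) \<I>)" unfolding admissible_def
    proof (intro conjI allI impI)
      show "insert (\<Union>F) \<I> \<subseteq> Pow Q" using F admissible unfolding admissible_def by blast
      fix G U assume G: "finite G" "G \<subseteq> insert (\<Union>F) \<I>" "U \<in> \<U>"
      then have "finite (F \<union> (G - {\<Union>F}))" "F \<union> (G - {\<Union>F}) \<subseteq> \<I>" using F by auto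
      then have "\<Lambda> \<le>o |U - \<Union>(F \<union> (G - {\<Union>F}))|" using G(3) by (intro admissibleD[OF admissible])
      also have "|U - \<Union>(F \<union> (G - {\<Union>F}))| \<le>o |U - \<Union>G|" by (intro card_of_mono1) blast
      finally show "\<Lambda> \<le>o |U - \<Union>G|" .
    qed
    then show ?thesis using max by blast
  qed
  have large: "\<Lambda> \<le>o |U - I|" if "I \<in> \<I>" "U \<in> \<U>" for I U
  proof -
    have "\<Lambda> \<le>o |U - \<Union>{I}|" using that by (intro admissibleD[OF admissible]) auto
    then show ?thesis by simp
  qed
  have outside: "\<exists>U\<in>\<U>. \<exists>I\<in>\<I>. |U - I - S| <o \<Lambda>" if S: "S \<subseteq> Q" "S \<notin> \<I>" for S
  proof -
    have "\<not> admissible (insert S \<I>)" using max[of "insert S \<I>"] S(2) by blast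
    moreover have "insert S \<I> \<subseteq> Pow Q" using admissible S(1) unfolding admissible_def by simp
    ultimately obtain F U where F: "finite F" "F \<subseteq> insert S \<I>" "U \<in> \<U>" "\<not> \<Lambda> \<le>o |U - \<Union>F|"
      unfolding admissible_def by metis
    have "|U - \<Union>(F - {S}) - S| \<le>o |U - \<Union>F|" by (intro card_of_mono1) blast
    also have "|U - \<Union>F| <o \<Lambda>" using F(4) \<Lambda>(1)
      by (metis card_of_Card_order card_order_on_well_order_on not_ordLeq_iff_ordLess)
    finally have "|U - \<Union>(F - {S}) - S| <o \<Lambda>" .
    moreover have "\<Union>(F - {S}) \<in> \<I>" using F by (intro unions) auto
    ultimately show ?thesis using F(3) by blast
  qed
  have small: "T \<in> \<I>" if T: "T \<subseteq> Q" "|T| <o \<Lambda>" for T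
  proof (rule ccontr)
    assume "T \<notin> \<I>"
    then obtain U I where U: "U \<in> \<U>" "I \<in> \<I>" "|U - I - T| <o \<Lambda>" using outside T by blast
    have "|U - I| \<le>o |(U - I - T) \<union> T|" by (intro card_of_mono1) blast
    also have "|(U - I - T) \<union> T| <o \<Lambda>" by (rule card_of_Un_ordLess_infinite_Field[OF \<Lambda>(2,1) U(3) T(2)])
    finally show False using large[OF U(2,1)] not_ordLess_ordLeq by blast
  qed
  have outside': "\<exists>U\<in>\<U>. \<exists>I\<in>\<I>. U \<inter> Q - I \<subseteq> S" if S: "S \<subseteq> Q" "S \<notin> \<I>" for S
  proof -
    obtain U I where U: "U \<in> \<U>" "I \<in> \<I>" "|U - I - S| <o \<Lambda>" using outside S by blast
    let ?T = "(U - I - S) \<inter> Q"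
    have "|?T| \<le>o |U - I - S|" by (intro card_of_mono1) blast
    then have "?T \<in> \<I>" using U(3) by (intro small) (auto intro: ordLeq_ordLess_trans)
    then have "\<Union>{I, ?T} \<in> \<I>" using U(2) by (intro unions) auto
    then show ?thesis using U(1) by (intro bexI[of _ U] bexI[of _ "\<Union>{I, ?T}"]) auto
  qed
  have "\<I> \<subseteq> Pow Q" using admissible unfolding admissible_def by (rule conjunct1)
  then show thesis by (rule that[OF _ unions small large outside'])
qed

lemma openin_unit_interval_positive:
  assumes "openin (top_of_set {0..1::real}) V" "V \<noteq> {}"
  shows "\<exists>r\<in>V. 0 < r"
proof (rule ccontr)
  assume neg: "\<not> (\<exists>r\<in>V. 0 < r)"
  have "V \<subseteq> {0..1}" using assms(1) by (rule openin_imp_subset)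
  then have "0 \<in> V" using neg assms(2) by fastforce
  then obtain e where e: "e > 0" "ball 0 e \<inter> {0..1} \<subseteq> V"
    using assms(1) unfolding openin_contains_ball by metis
  then have "min 1 (e/2) \<in> V" by auto
  then show False using neg e(1) by force
qed

text \<open>
  Infinite fibres let every member of the ideal be found again among the coordinates that a given box
  leaves free.
\<close>

lemma ex_surjection_infinite_fibres:
  fixes M :: "'m set" and \<J> :: "'j set"
  assumes "infinite M" "|\<J>| \<le>o |M|" "j0 \<in> \<J>"
  obtains g where "\<And>\<alpha>. g \<alpha> \<in> \<J>" "\<And>J F. J \<in> \<J> \<Longrightarrow> finite F \<Longrightarrow> \<exists>\<alpha>\<in>M - F. g \<alpha> = J"
proof -
  have "|UNIV :: nat set| \<le>o |M|" using assms(1) infinite_iff_card_of_nat by blast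
  then have "|\<J> \<times> (UNIV :: nat set)| \<le>o |M|"
    using assms by (intro card_of_Times_ordLeq_infinite_Field) (auto simp: Field_card_of card_of_card_order_on)
  moreover have "\<J> \<times> (UNIV :: nat set) \<noteq> {}" using assms(3) by blast
  ultimately obtain h where h: "h ` M = \<J> \<times> (UNIV :: nat set)"
    using card_of_ordLeq2 by metis
  define g where "g \<alpha> = (if \<alpha> \<in> M then fst (h \<alpha>) else j0)" for \<alpha>
  show thesis
  proof (rule that[of g])
    show "g \<alpha> \<in> \<J>" for \<alpha>
      unfolding g_def using h assms(3) by (metis SigmaE fst_conv imageI)
    fix J and F :: "'m set" assume J: "J \<in> \<J>" "finite F"
    have "infinite ({J} \<times> (UNIV :: nat set))" by (simp add: finite_cartesian_product_iff)
    moreover have "{J} \<times> (UNIV :: nat set) \<subseteq> h ` {\<alpha>\<in>M. g \<alpha> = J}"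
    proof
      fix z assume z: "z \<in> {J} \<times> (UNIV :: nat set)"
      then have "z \<in> h ` M" unfolding h using J(1) by auto
      then obtain \<alpha> where "\<alpha> \<in> M" "h \<alpha> = z" by blast
      then show "z \<in> h ` {\<alpha>\<in>M. g \<alpha> = J}" using z unfolding g_def by auto
    qed
    ultimately have "infinite {\<alpha>\<in>M. g \<alpha> = J}" by (meson finite_imageI finite_subset)
    then have "{\<alpha>\<in>M. g \<alpha> = J} - F \<noteq> {}" using J(2) by (metis finite.emptyI finite_Diff2)
    then show "\<exists>\<alpha>\<in>M - F. g \<alpha> = J" by blast
  qed
qed

text \<open>
  The irresolvable part of the space. Every point of \<open>P\<close> is multiplied by \<open>\<Lambda>\<close>, with the value 0
  replaced by 1 so that all coordinates are positive; thus the index set \<open>Q\<close> has \<open>\<Lambda>\<close> many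
  indices in every box. A maximal ideal \<open>\<I>\<close> of subsets of \<open>Q\<close> with large complements is then
  enumerated as \<open>I \<alpha>\<close> along the coordinates, and the coordinate \<open>\<alpha>\<close> is reset to 0 exactly on
  \<open>I \<alpha>\<close>. This keeps \<open>\<Lambda>\<close> many points in every box, because a box involves finitely
  many coordinates and hence loses only a member of \<open>\<I>\<close>. But every member of \<open>\<I>\<close> has become
  nowhere dense. A dense set \<open>S\<close> is thus outside \<open>\<I>\<close>, so by maximality it contains the trace of a box
  up to a member of \<open>\<I>\<close>, and after shrinking the box it contains the whole trace; every other dense
  set meets that trace.
\<close>

lemma ex_irresolvable_large_subset:
  fixes \<Lambda> :: "'l rel" and M :: "'m set"
  assumes \<Lambda>: "Card_order \<Lambda>" "infinite (Field \<Lambda>)"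
    and P: "G_delta_dense M P" "|P| \<le>o \<Lambda>"
    and M: "ctwo ^c \<Lambda> \<le>o |M|"
  obtains Z where "Z \<subseteq> (\<Pi>\<^sub>E \<alpha>\<in>M. {0..1})" "|Z| \<le>o \<Lambda>"
    "\<And>W. cube_box M W \<Longrightarrow> \<Lambda> \<le>o |Z \<inter> PiE M W|"
    "\<And>S S'. S \<subseteq> Z \<Longrightarrow> S' \<subseteq> Z \<Longrightarrow> (\<And>W. cube_box M W \<Longrightarrow> S \<inter> PiE M W \<noteq> {}) \<Longrightarrow>
       (\<And>W. cube_box M W \<Longrightarrow> S' \<inter> PiE M W \<noteq> {}) \<Longrightarrow> S \<inter> S' \<noteq> {}"
proof -
  define Q where "Q = P \<times> Field \<Lambda>"
  define pos where "pos r = (if r = 0 then 1 else r)" for r :: real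
  define trace where "trace W = {q\<in>Q. \<forall>\<alpha>\<in>M. pos (fst q \<alpha>) \<in> W \<alpha>}" for W
  have L\<Lambda>: "|Field \<Lambda>| =o \<Lambda>" using card_of_Field_ordIso \<Lambda>(1) .
  have cardQ: "|Q| \<le>o \<Lambda>" unfolding Q_def
    using \<Lambda> P(2) ordIso_imp_ordLeq[OF L\<Lambda>] by (intro card_of_Times_ordLeq_infinite_Field)
  have Pcube: "p \<alpha> \<in> {0..1}" if "p \<in> P" "\<alpha> \<in> M" for p \<alpha>
    using P(1) that unfolding G_delta_dense_def by (blast dest: PiE_mem)
  have pos01: "pos (fst q \<alpha>) \<in> {0..1}" "pos (fst q \<alpha>) > 0" if "q \<in> Q" "\<alpha> \<in> M" for q \<alpha>
    using Pcube[of "fst q" \<alpha>] that unfolding pos_def Q_def by auto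
  have trace_large: "\<Lambda> \<le>o |trace W|" if W: "cube_box M W" for W
  proof -
    have "\<exists>r\<in>W \<alpha>. 0 < r" if "\<alpha> \<in> M" for \<alpha>
      using W that unfolding cube_box_def by (intro openin_unit_interval_positive) auto
    then obtain y0 where y0: "\<And>\<alpha>. \<alpha> \<in> M \<Longrightarrow> y0 \<alpha> \<in> W \<alpha> \<and> 0 < y0 \<alpha>" by metis
    let ?y = "restrict y0 M"
    have "?y \<in> PiE M W" using y0 by simp
    then obtain p where p: "p \<in> P" "p \<in> PiE M W" "\<And>\<alpha>. \<alpha> \<in> M \<Longrightarrow> W \<alpha> \<noteq> {0..1} \<Longrightarrow> p \<alpha> = ?y \<alpha>"
      using G_delta_dense_meets_box[OF P(1) W, of ?y] by metis
    have "pos (p \<alpha>) \<in> W \<alpha>" if "\<alpha> \<in> M" for \<alpha>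
    proof (cases "W \<alpha> = {0..1}")
      case True
      then show ?thesis using Pcube[OF p(1) that] by (simp add: pos_def)
    next
      case False
      then show ?thesis using p(3)[OF that] y0[OF that] that by (simp add: pos_def)
    qed
    then have "{p} \<times> Field \<Lambda> \<subseteq> trace W" unfolding trace_def Q_def using p(1) by auto
    then have "|Field \<Lambda>| \<le>o |trace W|" by (intro card_of_ordLeqI[of "Pair p"]) (auto intro: inj_onI)
    then show ?thesis using ordIso_symmetric[OF L\<Lambda>] ordIso_ordLeq_trans by blast
  qed
  obtain \<I> where \<I>: "\<I> \<subseteq> Pow Q" "\<And>F. finite F \<Longrightarrow> F \<subseteq> \<I> \<Longrightarrow> \<Union>F \<in> \<I>"
    "\<And>T. T \<subseteq> Q \<Longrightarrow> |T| <o \<Lambda> \<Longrightarrow> T \<in> \<I>"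
    "\<And>I U. I \<in> \<I> \<Longrightarrow> U \<in> trace ` Collect (cube_box M) \<Longrightarrow> \<Lambda> \<le>o |U - I|"
    "\<And>S. S \<subseteq> Q \<Longrightarrow> S \<notin> \<I> \<Longrightarrow> \<exists>U\<in>trace ` Collect (cube_box M). \<exists>I\<in>\<I>. U \<inter> Q - I \<subseteq> S"
    by (rule maximal_ideal_with_large_complements[OF \<Lambda>, of "trace ` Collect (cube_box M)" Q])
      (use trace_large in auto)
  have "\<Union>{} \<in> \<I>" by (rule \<I>(2)) auto
  have card\<I>: "|\<I>| \<le>o |M|"
  proof -
    have "|Q| \<le>o |Field \<Lambda>|" using cardQ ordIso_symmetric[OF L\<Lambda>] by (rule ordLeq_ordIso_trans)
    then obtain h where h: "inj_on h Q" "h ` Q \<subseteq> Field \<Lambda>" unfolding card_of_ordLeq[symmetric] by blast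
    have "|\<I>| \<le>o |Pow Q|" using \<I>(1) by (rule card_of_mono1)
    also have "|Pow Q| \<le>o |Pow (Field \<Lambda>)|"
      using inj_on_image_Pow[OF h(1)] image_Pow_mono[OF h(2)]
      by (intro card_of_ordLeqI[of "(`) h"]) blast+
    also have "|Pow (Field \<Lambda>)| =o |Func (Field \<Lambda>) (UNIV :: bool set)|" by (rule card_of_Pow_Func)
    also have "|Func (Field \<Lambda>) (UNIV :: bool set)| = ctwo ^c \<Lambda>"
      by (simp add: cexp_def ctwo_def Field_card_of)
    also note M
    finally show ?thesis .
  qed
  have "infinite M"
  proof -
    have "cinfinite (ctwo ^c \<Lambda>)"
      using \<Lambda> by (intro cinfinite_cexp) (auto simp: cinfinite_def ctwo_def intro: card_of_mono1)
    then have "cinfinite |M|" using M cinfinite_mono by blast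
    then show ?thesis by (simp add: cinfinite_def Field_card_of)
  qed
  obtain I where I: "\<And>\<alpha>. I \<alpha> \<in> \<I>" "\<And>J F. J \<in> \<I> \<Longrightarrow> finite F \<Longrightarrow> \<exists>\<alpha>\<in>M - F. I \<alpha> = J"
    using ex_surjection_infinite_fibres[OF \<open>infinite M\<close> card\<I> \<open>\<Union>{} \<in> \<I>\<close>] by metis
  define x where "x q = (\<lambda>\<alpha>\<in>M. if q \<in> I \<alpha> then 0 else pos (fst q \<alpha>))" for q
  have x0: "x q \<alpha> = 0 \<longleftrightarrow> q \<in> I \<alpha>" if "q \<in> Q" "\<alpha> \<in> M" for q \<alpha>
    using pos01[OF that] that unfolding x_def by auto
  have xcube: "x q \<in> (\<Pi>\<^sub>E \<alpha>\<in>M. {0..1})" if "q \<in> Q" for q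
    using pos01(1)[OF that] unfolding x_def by auto
  \<comment> \<open>Indices that a given box may lose through the resetting.\<close>
  have bad: "(\<Union>\<alpha>\<in>{\<alpha>\<in>M. W \<alpha> \<noteq> {0..1}}. I \<alpha>) \<in> \<I>" if "cube_box M W" for W
    using that I(1) unfolding cube_box_def by (intro \<I>(2)) auto
  \<comment> \<open>Singletons belong to the ideal, so every index is the only zero of some coordinate.\<close>
  have inj: "inj_on x Q"
  proof (rule inj_onI, rule ccontr)
    fix q q' assume q: "q \<in> Q" "q' \<in> Q" "x q = x q'" "q \<noteq> q'"
    have "|{q}| <o \<Lambda>"
      using \<Lambda> by (intro finite_ordLess_infinite) (auto simp: Field_card_of card_of_well_order_on card_order_on_well_order_on)
    then have "{q} \<in> \<I>" using q(1) by (intro \<I>(3)) auto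
    then obtain \<alpha> where \<alpha>: "\<alpha> \<in> M" "I \<alpha> = {q}" using I(2)[of "{q}" "{}"] by auto
    have "x q \<alpha> = 0" using x0[OF q(1) \<alpha>(1)] unfolding \<alpha>(2) by blast
    then have "q' \<in> I \<alpha>" using x0[OF q(2) \<alpha>(1)] unfolding q(3) by blast
    then show False using q(4) unfolding \<alpha>(2) by blast
  qed
  show thesis
  proof (rule that[of "x ` Q"])
    show "x ` Q \<subseteq> (\<Pi>\<^sub>E \<alpha>\<in>M. {0..1})" using xcube by blast
    show "|x ` Q| \<le>o \<Lambda>" using card_of_image cardQ by (rule ordLeq_transitive)
  next
    fix W assume W: "cube_box M W"
    let ?B = "\<Union>\<alpha>\<in>{\<alpha>\<in>M. W \<alpha> \<noteq> {0..1}}. I \<alpha>"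
    have "x q \<in> PiE M W" if "q \<in> trace W - ?B" for q
    proof -
      have "q \<in> Q" using that unfolding trace_def by blast
      have "x q \<alpha> \<in> W \<alpha>" if "\<alpha> \<in> M" for \<alpha>
      proof (cases "W \<alpha> = {0..1}")
        case True
        then show ?thesis using PiE_mem[OF xcube[OF \<open>q \<in> Q\<close>] that] by simp
      next
        case False
        then show ?thesis using \<open>q \<in> trace W - ?B\<close> that unfolding x_def trace_def by auto
      qed
      then show ?thesis using xcube[OF \<open>q \<in> Q\<close>] by (simp add: PiE_iff)
    qed
    then have "|trace W - ?B| \<le>o |x ` Q \<inter> PiE M W|"
      using inj_on_subset[OF inj, of "trace W - ?B"]
      by (intro card_of_ordLeqI[of x]) (auto simp: trace_def)
    moreover have "\<Lambda> \<le>o |trace W - ?B|" using \<I>(4)[OF bad[OF W]] W by simp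
    ultimately show "\<Lambda> \<le>o |x ` Q \<inter> PiE M W|" by (rule ordLeq_transitive[rotated])
  next
    fix S S' assume S: "S \<subseteq> x ` Q" "\<And>W. cube_box M W \<Longrightarrow> S \<inter> PiE M W \<noteq> {}"
      and S': "S' \<subseteq> x ` Q" "\<And>W. cube_box M W \<Longrightarrow> S' \<inter> PiE M W \<noteq> {}"
    have shrink: "cube_box M (W(\<alpha> := {0<..1}))" if "cube_box M W" for W \<alpha>
    proof -
      have "{0<..1} = {0..1} \<inter> {0::real<..}" by auto
      then have "openin (top_of_set {0..1}) {0::real<..1}" by (metis openin_open_Int open_greaterThan)
      moreover have "{\<beta>\<in>M. (W(\<alpha> := {0<..1})) \<beta> \<noteq> {0..1}} \<subseteq> insert \<alpha> {\<beta>\<in>M. W \<beta> \<noteq> {0..1}}" by auto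
      moreover have "finite (insert \<alpha> {\<beta>\<in>M. W \<beta> \<noteq> {0..1}})" using that unfolding cube_box_def by simp
      ultimately have "openin (top_of_set {0..1}) {0::real<..1}"
          "finite {\<beta>\<in>M. (W(\<alpha> := {0<..1})) \<beta> \<noteq> {0..1}}"
        using finite_subset by blast+
      then show ?thesis using that unfolding cube_box_def by simp
    qed
    let ?S0 = "{q\<in>Q. x q \<in> S}"
    have "?S0 \<notin> \<I>"
    proof
      assume "?S0 \<in> \<I>"
      then obtain \<alpha> where \<alpha>: "\<alpha> \<in> M" "I \<alpha> = ?S0" using I(2)[of ?S0 "{}"] by auto
      have "cube_box M (\<lambda>_. {0..1})" by (simp add: cube_box_def)
      from S(2)[OF shrink[OF this, of \<alpha>]] obtain s where
        s: "s \<in> S" "s \<in> PiE M ((\<lambda>_. {0..1})(\<alpha> := {0<..1}))" by blast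
      then obtain q where q: "q \<in> Q" "s = x q" using S(1) by blast
      then have "s \<alpha> = 0" using x0[OF q(1) \<alpha>(1)] s(1) \<alpha>(2) by simp
      then show False using PiE_mem[OF s(2) \<alpha>(1)] by simp
    qed
    then obtain W J where W: "cube_box M W" "J \<in> \<I>" "trace W \<inter> Q - J \<subseteq> ?S0"
      using \<I>(5)[of ?S0] by auto
    \<comment> \<open>\<open>?J\<close> collects all indices where the box \<open>W\<close> may fail to be contained in \<open>S\<close>. Since \<open>?J\<close>
      is the zero set of some coordinate outside the support of \<open>W\<close>, requiring that coordinate
      to be positive shrinks \<open>W\<close> to a nonempty box that avoids \<open>?J\<close>.\<close>
    let ?F = "{\<alpha>\<in>M. W \<alpha> \<noteq> {0..1}}"
    let ?J = "\<Union>{J, \<Union>\<alpha>\<in>?F. I \<alpha>}"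
    have "?J \<in> \<I>" using W(2) bad[OF W(1)] by (intro \<I>(2)) auto
    moreover have "finite ?F" using W(1) unfolding cube_box_def by blast
    ultimately have "\<exists>\<alpha>\<in>M - ?F. I \<alpha> = ?J" by (rule I(2))
    then obtain \<alpha> where "\<alpha> \<in> M - ?F" and IJ: "I \<alpha> = ?J" by (rule bexE)
    then have \<alpha>: "\<alpha> \<in> M" "\<alpha> \<notin> ?F" by simp_all
    from S'(2)[OF shrink[OF W(1), of \<alpha>]] obtain s where
      s: "s \<in> S'" "s \<in> PiE M (W(\<alpha> := {0<..1}))" by blast
    then obtain q where q: "q \<in> Q" "s = x q" using S'(1) by blast
    have "s \<alpha> \<noteq> 0" using PiE_mem[OF s(2) \<alpha>(1)] by simp
    then have qJ: "q \<notin> ?J" using x0[OF q(1) \<alpha>(1)] q(2) unfolding IJ by simp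
    have "pos (fst q \<beta>) \<in> W \<beta>" if "\<beta> \<in> M" for \<beta>
    proof (cases "W \<beta> = {0..1}")
      case True
      then show ?thesis using pos01(1)[OF q(1) that] by simp
    next
      case False
      then have "\<beta> \<noteq> \<alpha>" "q \<notin> I \<beta>" using \<alpha>(2) qJ that by auto
      then show ?thesis using PiE_mem[OF s(2) that] q(2) that by (simp add: x_def)
    qed
    then have "q \<in> trace W" using q(1) unfolding trace_def by simp
    then have "q \<in> ?S0" using W(3) q(1) qJ by blast
    then show "S \<inter> S' \<noteq> {}" using s(1) q(2) by blast
  qed
qed

section \<open>Transfer of the space and the main result\<close>

text \<open>
  Choosing a point of \<open>P\<close> in each member that meets \<open>P\<close> is injective by disjointness, so at most
  \<open>\<kappa>\<close> members meet \<open>P\<close>.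
\<close>

lemma two_members_avoid_small_set:
  assumes \<kappa>: "Card_order \<kappa>" "infinite (Field \<kappa>)" and P: "|P| \<le>o \<kappa>"
    and \<D>: "pairwise disjnt \<D>" "\<kappa> <o |\<D>|"
  obtains D1 D2 where "D1 \<in> \<D>" "D2 \<in> \<D>" "D1 \<noteq> D2" "D1 \<inter> P = {}" "D2 \<inter> P = {}"
proof -
  let ?H = "{D\<in>\<D>. D \<inter> P \<noteq> {}}"
  have "\<exists>p. \<forall>D\<in>?H. p D \<in> D \<inter> P" by (rule bchoice) blast
  then obtain p where p: "\<And>D. D \<in> ?H \<Longrightarrow> p D \<in> D \<inter> P" by blast
  have "inj_on p ?H"
  proof (rule inj_onI, rule ccontr)
    fix D D' assume "D \<in> ?H" "D' \<in> ?H" "p D = p D'" "D \<noteq> D'"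
    moreover from this have "disjnt D D'" using \<D>(1) unfolding pairwise_def by blast
    ultimately show False using p[of D] p[of D'] unfolding disjnt_iff by auto
  qed
  then have "|?H| \<le>o |P|" using p by (intro card_of_ordLeqI[of p]) auto
  then have H: "|?H| \<le>o \<kappa>" using P by (rule ordLeq_transitive)
  have "\<not> (\<exists>D1. \<D> - ?H \<subseteq> {D1})"
  proof
    assume "\<exists>D1. \<D> - ?H \<subseteq> {D1}"
    then have "finite (\<D> - ?H)" using finite_subset by blast
    then have "|\<D> - ?H| <o \<kappa>" using \<kappa>
      by (intro finite_ordLess_infinite)
        (auto simp: Field_card_of card_of_well_order_on card_order_on_well_order_on)
    then have "|?H \<union> (\<D> - ?H)| \<le>o \<kappa>"
      by (rule card_of_Un_ordLeq_infinite_Field[OF \<kappa>(2) H ordLess_imp_ordLeq \<kappa>(1)])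
    moreover have "?H \<union> (\<D> - ?H) = \<D>" by blast
    ultimately have "|\<D>| \<le>o \<kappa>" by simp
    then show False using \<D>(2) not_ordLess_ordLeq by blast
  qed
  then have two: "\<exists>D2\<in>\<D> - ?H. D1 \<noteq> D2" for D1 by blast
  then obtain D1 where "D1 \<in> \<D> - ?H" by blast
  moreover obtain D2 where "D2 \<in> \<D> - ?H" "D1 \<noteq> D2" using two by blast
  ultimately have "D1 \<in> \<D>" "D2 \<in> \<D>" "D1 \<noteq> D2" "D1 \<inter> P = {}" "D2 \<inter> P = {}" by simp_all
  then show thesis by (rule that)
qed

lemma homeomorphic_map_pullback_topology:
  assumes "bij_betw g L E" "E \<subseteq> topspace T"
  shows "homeomorphic_map (pullback_topology L g T) (subtopology T E) g"
proof (rule bijective_open_imp_homeomorphic_map)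
  have top: "topspace (pullback_topology L g T) = L"
    using assms unfolding topspace_pullback_topology bij_betw_def by auto
  have img: "g ` L = E" and inj: "inj_on g L" using assms(1) by (auto simp: bij_betw_def)
  show "continuous_map (pullback_topology L g T) (subtopology T E) g"
    unfolding continuous_map_in_subtopology top
    using continuous_map_pullback[OF continuous_map_id, of L g T] img by auto
  show "open_map (pullback_topology L g T) (subtopology T E) g"
    unfolding open_map_def openin_pullback_topology openin_subtopology
  proof (intro allI impI, elim exE conjE)
    fix U V assume "openin T V" "U = g -` V \<inter> L"
    then show "\<exists>V. openin T V \<and> g ` U = V \<inter> E" using img by (intro exI[of _ V]) auto
  qed
  show "g ` topspace (pullback_topology L g T) = topspace (subtopology T E)"
    using assms(2) img unfolding top by auto
  show "inj_on g (topspace (pullback_topology L g T))" using inj unfolding top .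
qed

lemma homeomorphic_pseudocompact_space:
  assumes "X homeomorphic_space Y" "pseudocompact_space Y"
  shows "pseudocompact_space X"
proof -
  obtain g h where gh: "homeomorphic_maps X Y g h" using assms(1) unfolding homeomorphic_space_def by blast
  show ?thesis unfolding pseudocompact_space_def
  proof (intro allI impI)
    fix f assume f: "continuous_map X euclideanreal f"
    have "continuous_map Y euclideanreal (f \<circ> h)"
      using gh f unfolding homeomorphic_maps_def by (blast intro: continuous_map_compose)
    then have "bounded ((f \<circ> h) ` topspace Y)" using assms(2) unfolding pseudocompact_space_def by blast
    moreover have "f x = (f \<circ> h) (g x)" "g x \<in> topspace Y" if "x \<in> topspace X" for x
      using gh that continuous_map_image_subset_topspace unfolding homeomorphic_maps_def by fastforce+
    then have "f ` topspace X \<subseteq> (f \<circ> h) ` topspace Y" by blast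
    ultimately show "bounded (f ` topspace X)" by (rule bounded_subset)
  qed
qed

theorem theorem4p4:
  fixes \<kappa> :: "'k rel" and \<Lambda> :: "'l rel" and \<mu> :: "'m rel"
  assumes "Card_order \<kappa>" and "Card_order \<Lambda>" and "Card_order \<mu>"
    and "continuum \<le>o \<kappa>"
    and "\<kappa> =o \<kappa> ^c natLeq"
    and "\<kappa> <o \<Lambda>"
    and "ctwo ^c \<kappa> =o \<mu>"
    and "ctwo ^c \<Lambda> =o \<mu>"
  shows "\<exists>X :: 'l topology.
           irresolvable_space (cardSuc \<kappa>) X \<and>
           connected_space X \<and>
           locally_connected_space X \<and>
           pseudocompact_space X \<and>
           |topspace X| =o \<Lambda> \<and>
           dispersion_character X =o \<Lambda> \<and>
           (\<exists>D. dense_subset (unit_cube \<mu>) D \<and>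
                X homeomorphic_space subtopology (unit_cube \<mu>) D)"
proof -
  let ?M = "Field \<mu>" and ?L = "Field \<Lambda>"
  let ?T = "Cube ?M"
  have M\<mu>: "|?M| =o \<mu>" and L\<Lambda>: "|?L| =o \<Lambda>" using card_of_Field_ordIso assms(2,3) by blast+
  have \<kappa>\<Lambda>: "\<kappa> \<le>o \<Lambda>" using assms(6) by (rule ordLess_imp_ordLeq)
  have "cinfinite continuum"
    using ordLeq_refl[OF Card_order_ctwo] natLeq_Cinfinite by (rule cinfinite_cexp)
  with assms(4) have "cinfinite \<kappa>" by (rule cinfinite_mono)
  with \<kappa>\<Lambda> have "cinfinite \<Lambda>" by (rule cinfinite_mono)
  with \<open>cinfinite \<kappa>\<close> have inf\<kappa>: "infinite (Field \<kappa>)" and inf\<Lambda>: "infinite ?L"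
    unfolding cinfinite_def by auto

  \<comment> \<open>The small part \<open>P\<close>, carrying pseudocompactness and connectedness.\<close>
  have "|?M| \<le>o ctwo ^c \<kappa>"
    using M\<mu> ordIso_symmetric[OF assms(7)] by (blast intro: ordIso_imp_ordLeq ordIso_transitive)
  then obtain P0 where P0: "G_delta_dense ?M P0" "|P0| \<le>o \<kappa>"
    using ex_small_G_delta_dense[OF assms(1,4,5)] by metis
  moreover have "P0 \<subseteq> (\<Pi>\<^sub>E \<alpha>\<in>?M. {0..1})" using P0(1) unfolding G_delta_dense_def by blast
  ultimately obtain P where P: "P0 \<subseteq> P" "P \<subseteq> (\<Pi>\<^sub>E \<alpha>\<in>?M. {0..1})" "segment_closed ?M P" "|P| \<le>o \<kappa>"
    using segment_closure[OF assms(1,4) inf\<kappa>, of P0 ?M] by metis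
  have Pdense: "G_delta_dense ?M P" using G_delta_dense_mono[OF P0(1) P(1,2)] .
  have P\<Lambda>: "|P| \<le>o \<Lambda>" using P(4) \<kappa>\<Lambda> by (rule ordLeq_transitive)
  \<comment> \<open>The large part \<open>Z\<close>, carrying the dispersion character and irresolvability.\<close>
  have "ctwo ^c \<Lambda> \<le>o |?M|"
    using assms(8) ordIso_symmetric[OF M\<mu>] by (blast intro: ordIso_imp_ordLeq ordIso_transitive)
  then obtain Z where Z: "Z \<subseteq> (\<Pi>\<^sub>E \<alpha>\<in>?M. {0..1})" "|Z| \<le>o \<Lambda>"
    "\<And>W. cube_box ?M W \<Longrightarrow> \<Lambda> \<le>o |Z \<inter> PiE ?M W|"
    "\<And>S S'. S \<subseteq> Z \<Longrightarrow> S' \<subseteq> Z \<Longrightarrow> (\<And>W. cube_box ?M W \<Longrightarrow> S \<inter> PiE ?M W \<noteq> {}) \<Longrightarrow>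
       (\<And>W. cube_box ?M W \<Longrightarrow> S' \<inter> PiE ?M W \<noteq> {}) \<Longrightarrow> S \<inter> S' \<noteq> {}"
    by (rule ex_irresolvable_large_subset[OF assms(2) inf\<Lambda> Pdense P\<Lambda>]) blast

  define E where "E = P \<union> Z"
  have E: "P \<subseteq> E" "E \<subseteq> (\<Pi>\<^sub>E \<alpha>\<in>?M. {0..1})" using P(2) Z(1) unfolding E_def by auto
  have Edense: "G_delta_dense ?M E" using G_delta_dense_mono[OF Pdense E] .
  have Ebox: "\<Lambda> \<le>o |E \<inter> PiE ?M W|" if "cube_box ?M W" for W
    using Z(3)[OF that] by (rule ordLeq_transitive) (auto intro: card_of_mono1 simp: E_def)
  have "|E| \<le>o \<Lambda>" unfolding E_def
    using inf\<Lambda> P\<Lambda> Z(2) assms(2) by (rule card_of_Un_ordLeq_infinite_Field)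
  moreover have "\<Lambda> \<le>o |E|"
  proof -
    have "cube_box ?M (\<lambda>_. {0..1})" by (simp add: cube_box_def)
    from Ebox[OF this] show ?thesis by (rule ordLeq_transitive) (auto intro: card_of_mono1)
  qed
  ultimately have "|E| =o \<Lambda>" by (simp add: ordIso_iff_ordLeq)
  then have "|?L| =o |E|" using L\<Lambda> ordIso_symmetric ordIso_transitive by blast
  then obtain g where g: "bij_betw g ?L E" using card_of_ordIso by blast
  then have img: "g ` ?L = E" and inj: "inj_on g ?L" by (auto simp: bij_betw_def)

  \<comment> \<open>The union has size \<open>\<Lambda>\<close>, so its topology can be moved to the field of \<open>\<Lambda>\<close>.\<close>
  define X where "X = pullback_topology ?L g ?T"
  have Etop: "E \<subseteq> topspace ?T" using E(2) by simp
  have top: "topspace X = ?L"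
    using img Etop unfolding X_def topspace_pullback_topology by auto
  have homeo: "X homeomorphic_space subtopology ?T E"
    using homeomorphic_map_pullback_topology[OF g Etop] unfolding X_def
    by (rule homeomorphic_map_imp_homeomorphic_space)

  have open_large: "\<Lambda> \<le>o |U|" if U: "openin X U" "U \<noteq> {}" for U
  proof -
    obtain V where V: "openin ?T V" "U = g -` V \<inter> ?L"
      using U(1) unfolding X_def openin_pullback_topology by blast
    then obtain l where "g l \<in> V" using U(2) by blast
    from convex_box_neighbourhood[OF V(1) this] obtain W where W: "cube_box ?M W" "PiE ?M W \<subseteq> V" by metis
    have "E \<inter> PiE ?M W \<subseteq> g ` U" using W(2) V(2) img by auto
    then have "|E \<inter> PiE ?M W| \<le>o |U|" by (rule surj_imp_ordLeq)
    with Ebox[OF W(1)] show ?thesis by (rule ordLeq_transitive)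
  qed
  have "?L \<noteq> {}" using inf\<Lambda> by auto
  then obtain U where U: "openin X U" "U \<noteq> {}" "dispersion_character X = |U|"
    using dispersion_character_attained[of X] top by auto
  have "|U| \<le>o |?L|" using openin_subset[OF U(1)] top by (simp add: card_of_mono1)
  then have disp: "dispersion_character X =o \<Lambda>"
    using open_large[OF U(1,2)] L\<Lambda> U(3) by (simp add: ordIso_iff_ordLeq) (metis ordLeq_transitive)

  have "\<not> resolvable_space (cardSuc \<kappa>) X"
  proof
    assume "resolvable_space (cardSuc \<kappa>) X"
    then obtain \<D> :: "'l set set" where \<D>: "|\<D>| =o cardSuc \<kappa>" "pairwise disjnt \<D>"
      "\<forall>D\<in>\<D>. dense_subset X D"
      unfolding resolvable_space_def by blast
    have meets: "g ` D \<inter> PiE ?M W \<noteq> {}" if DW: "D \<in> \<D>" "cube_box ?M W" for D W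
    proof -
      have "openin X (g -` PiE ?M W \<inter> ?L)"
        unfolding X_def openin_pullback_topology using openin_box[OF DW(2)] by blast
      moreover have "g -` PiE ?M W \<inter> ?L \<noteq> {}"
      proof -
        obtain y where "y \<in> PiE ?M W" using box_nonempty[OF DW(2)] by blast
        then obtain z where z: "z \<in> E" "z \<in> PiE ?M W"
          using G_delta_dense_meets_box[OF Edense DW(2)] by metis
        then obtain l where "l \<in> ?L" "g l = z" using img by (metis imageE)
        with z(2) show ?thesis by blast
      qed
      moreover have "X closure_of D = topspace X"
        using \<D>(3) DW(1) unfolding dense_subset_def by blast
      ultimately have "D \<inter> (g -` PiE ?M W \<inter> ?L) \<noteq> {}" unfolding dense_intersects_open by metis
      then show ?thesis by blast
    qed
    let ?P = "{l\<in>?L. g l \<in> P}"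
    have "|?P| \<le>o |P|" using inj by (intro card_of_ordLeqI[of g]) (auto intro: inj_on_subset)
    then have P\<kappa>: "|?P| \<le>o \<kappa>" using P(4) by (rule ordLeq_transitive)
    have \<kappa>\<D>: "\<kappa> <o |\<D>|"
      using cardSuc_greater[OF assms(1)] ordIso_symmetric[OF \<D>(1)] by (rule ordLess_ordIso_trans)
    obtain D1 D2 where D: "D1 \<in> \<D>" "D2 \<in> \<D>" "D1 \<noteq> D2" "D1 \<inter> ?P = {}" "D2 \<inter> ?P = {}"
      by (rule two_members_avoid_small_set[OF assms(1) inf\<kappa> P\<kappa> \<D>(2) \<kappa>\<D>])
    have sub: "D1 \<subseteq> ?L" "D2 \<subseteq> ?L" using \<D>(3) D(1,2) top unfolding dense_subset_def by auto
    have inZ: "g l \<in> Z" if "l \<in> ?L" "l \<notin> ?P" for l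
      using that imageI[OF that(1), of g] unfolding img E_def by simp
    have "g ` D1 \<subseteq> Z" using inZ sub(1) D(4) by (intro image_subsetI) (simp add: disjoint_iff subset_iff)
    moreover have "g ` D2 \<subseteq> Z"
      using inZ sub(2) D(5) by (intro image_subsetI) (simp add: disjoint_iff subset_iff)
    ultimately have "g ` D1 \<inter> g ` D2 \<noteq> {}"
      using meets[OF D(1)] meets[OF D(2)] by (rule Z(4))
    then have "D1 \<inter> D2 \<noteq> {}" using inj_on_image_Int[OF inj sub] by auto
    moreover have "disjnt D1 D2" using \<D>(2) D(1-3) unfolding pairwise_def by blast
    ultimately show False unfolding disjnt_def by blast
  qed
  moreover have "cardSuc \<kappa> \<le>o dispersion_character X"
    using cardSuc_least[OF assms(1,2,6)] ordIso_symmetric[OF disp] by (rule ordLeq_ordIso_trans)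
  ultimately have "irresolvable_space (cardSuc \<kappa>) X" unfolding irresolvable_space_def by blast
  moreover have "connected_space X"
    using homeomorphic_connected_space[OF homeo]
      dense_segment_closed_imp_connected[OF P(3) Pdense E] by blast
  moreover have "locally_connected_space X"
    using homeomorphic_locally_connected_space[OF homeo]
      dense_segment_closed_imp_locally_connected[OF P(3) Pdense E] by blast
  moreover have "pseudocompact_space X"
    using homeo G_delta_dense_imp_pseudocompact[OF Edense] by (rule homeomorphic_pseudocompact_space)
  moreover have "|topspace X| =o \<Lambda>" using L\<Lambda> top by simp
  moreover have "dense_subset (unit_cube \<mu>) E"
    unfolding dense_subset_def unit_cube_def using G_delta_dense_imp_dense[OF Edense] by blast
  moreover have "X homeomorphic_space subtopology (unit_cube \<mu>) E" using homeo unfolding unit_cube_def .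
  ultimately show ?thesis using disp by blast
qed

end
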